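(* Let $\mathcal L$ be a finite lattice and let $(\mathcal L,w)$ be a cover-weighted lattice. 1. Let $r:\mathcal L\to\mathbb R_{\ge0}$ satisfy the rank axioms (R1)–(R3). Define $w_r([A,B])=r(B)-r(A)$ for every cover $A\lessdot B$. Then $(\mathcal L,w_r)$ is a cover-weighted lattice satisfying the interval-weight axioms (IW1) and (IW2). 2. Suppose $(\mathcal L,w)$ satisfies (IW1) and (IW2). Define $r_w(A)=\sum_{i=1}^m w([X_{i-1},X_i])$ for any maximal chain $\mathbf 0=X_0\lessdot\cdots\lessdot X_m=A$. Then $r_w$ is well defined and satisfies (R1)–(R3). 3. In these situations, $w_{r_w}=w$ and $r_{w_r}=r$.
   Context: $\mathcal L$ has least element $\mathbf 0$ and height function $\mathrm h$. A cover-weighted lattice $(\mathcal L,w)$ is a lattice together with a function $w$ assigning a value $w([A,B])\in\mathbb R_{\ge0}$ to each cover $A\lessdot B$. Interval-weight axioms: - (IW1) For every interval $[A,B]$ and every maximal chain $A=X_0\lessdot\cdots\lessdot X_m=B$, the sum $\sum_{i=1}^m w([X_{i-1},X_i])$ is the same; this common value is denoted $w([A,B])$. - (IW2) (IW1) holds, and $w([A,X\vee A])\le w([A\wedge X,X])$ for all $A,X\in\mathcal L$. Rank axioms for $r:\mathcal L\to\mathbb R$, for some $t\ge0$ and all $A,B$: - (R1) $0\le r(A)\le t\,\mathrm h(A)$; - (R2) $A\le B$ implies $r(A)\le r(B)$; - (R3) $r(A)-r(A\wedge B)\ge r(A\vee B)-r(B)$. *)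

theory Defs
  imports Complex_Main
begin

definition covers :: "'a::order \<Rightarrow> 'a \<Rightarrow> bool" (infix "\<lessdot>" 50) where
  "A \<lessdot> B \<longleftrightarrow> A < B \<and> \<not> (\<exists>C. A < C \<and> C < B)"

text \<open>Maximal chains of the interval from \<open>A\<close> to \<open>B\<close>; only the values \<open>X 0, \<dots>, X m\<close> matter.\<close>

definition maximal_chain :: "'a::order \<Rightarrow> 'a \<Rightarrow> nat \<Rightarrow> (nat \<Rightarrow> 'a) \<Rightarrow> bool" where
  "maximal_chain A B m X \<longleftrightarrow> X 0 = A \<and> X m = B \<and> (\<forall>i\<in>{1..m}. X (i - 1) \<lessdot> X i)"

text \<open>The lattice need not be graded: the height is the largest length of a chain from the
  least element.\<close>

definition height :: "'a::{finite,bounded_lattice_bot} \<Rightarrow> nat" where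
  "height A = Max {m. \<exists>X. X 0 = bot \<and> X m = A \<and> (\<forall>i\<in>{1..m}. X (i - 1) < X i)}"

text \<open>A cover weight is a binary function of which only the values on pairs \<open>A \<lessdot> B\<close> are
  meaningful.\<close>

definition cover_weighted :: "('a::lattice \<Rightarrow> 'a \<Rightarrow> real) \<Rightarrow> bool" where
  "cover_weighted w \<longleftrightarrow> (\<forall>A B. A \<lessdot> B \<longrightarrow> 0 \<le> w A B)"

definition chain_weight :: "('a \<Rightarrow> 'a \<Rightarrow> real) \<Rightarrow> nat \<Rightarrow> (nat \<Rightarrow> 'a) \<Rightarrow> real" where
  "chain_weight w m X = (\<Sum>i=1..m. w (X (i - 1)) (X i))"

definition IW1 :: "('a::lattice \<Rightarrow> 'a \<Rightarrow> real) \<Rightarrow> bool" where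
  "IW1 w \<longleftrightarrow> (\<forall>A B m X n Y. A \<le> B \<and> maximal_chain A B m X \<and> maximal_chain A B n Y
     \<longrightarrow> chain_weight w m X = chain_weight w n Y)"

definition interval_weight :: "('a::lattice \<Rightarrow> 'a \<Rightarrow> real) \<Rightarrow> 'a \<Rightarrow> 'a \<Rightarrow> real" where
  "interval_weight w A B = (THE s. \<exists>m X. maximal_chain A B m X \<and> s = chain_weight w m X)"

definition IW2 :: "('a::lattice \<Rightarrow> 'a \<Rightarrow> real) \<Rightarrow> bool" where
  "IW2 w \<longleftrightarrow> IW1 w \<and>
     (\<forall>A X. interval_weight w A (sup X A) \<le> interval_weight w (inf A X) X)"

definition R1 :: "real \<Rightarrow> ('a::{finite,bounded_lattice_bot} \<Rightarrow> real) \<Rightarrow> bool" where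
  "R1 t r \<longleftrightarrow> (\<forall>A. 0 \<le> r A \<and> r A \<le> t * real (height A))"

definition R2 :: "('a::lattice \<Rightarrow> real) \<Rightarrow> bool" where
  "R2 r \<longleftrightarrow> (\<forall>A B. A \<le> B \<longrightarrow> r A \<le> r B)"

definition R3 :: "('a::lattice \<Rightarrow> real) \<Rightarrow> bool" where
  "R3 r \<longleftrightarrow> (\<forall>A B. r A - r (inf A B) \<ge> r (sup A B) - r B)"

definition rank_function :: "('a::{finite,bounded_lattice_bot} \<Rightarrow> real) \<Rightarrow> bool" where
  "rank_function r \<longleftrightarrow> (\<exists>t\<ge>0. R1 t r) \<and> R2 r \<and> R3 r"

definition weight_of_rank :: "('a \<Rightarrow> real) \<Rightarrow> 'a \<Rightarrow> 'a \<Rightarrow> real" where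
  "weight_of_rank r A B = r B - r A"

definition rank_of_weight :: "('a::bounded_lattice_bot \<Rightarrow> 'a \<Rightarrow> real) \<Rightarrow> 'a \<Rightarrow> real" where
  "rank_of_weight w A = (THE s. \<exists>m X. maximal_chain bot A m X \<and> s = chain_weight w m X)"

end

theory Submission imports Defs begin

text \<open>Along a maximal chain the weight of a rank function telescopes, so \<open>w\<^sub>r([A,B]) = r(B) - r(A)\<close>
  for every interval and not only for covers; (IW2) for \<open>w\<^sub>r\<close> is then literally (R3) for \<open>r\<close>.
  Conversely, appending a cover \<open>A \<lessdot> B\<close> to a maximal chain from \<open>\<zero>\<close> to \<open>A\<close> shows that
  \<open>r\<^sub>w(B) - r\<^sub>w(A) = w([A,B])\<close>, so \<open>w\<close> is the weight of \<open>r\<^sub>w\<close> and the first observation applies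
  to it. For (R1) one takes \<open>t\<close> to be the total weight of all covers.\<close>

lemma maximal_chain_0: "maximal_chain A A 0 (\<lambda>_. A)"
  by (simp add: maximal_chain_def)

lemma maximal_chain_extend:
  assumes "maximal_chain A B m X" and "B \<lessdot> C"
  shows "maximal_chain A C (Suc m) (X(Suc m := C))"
  using assms by (auto simp: maximal_chain_def)

lemma chain_weight_extend:
  "chain_weight w (Suc m) (X(Suc m := C)) = chain_weight w m X + w (X m) C"
proof -
  \<comment> \<open>The update at \<open>Suc m\<close> leaves all indices up to \<open>m\<close>
    alone, so the first \<open>m\<close> summands are the old ones.\<close>
  have "(\<Sum>i=1..m. w ((X(Suc m := C)) (i - 1)) ((X(Suc m := C)) i)) = chain_weight w m X"
    unfolding chain_weight_def by (intro sum.cong) auto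
  then show ?thesis by (simp add: chain_weight_def)
qed

text \<open>By finiteness some \<open>C\<close> is maximal among the elements that are at least
  \<open>A\<close> and strictly below \<open>B\<close>. Then \<open>B\<close> covers
  \<open>C\<close>, and a maximal chain up to \<open>C\<close> extends by one step.\<close>

lemma maximal_chain_exists:
  fixes A B :: "'a::{finite,order}"
  assumes "A \<le> B"
  shows "\<exists>m X. maximal_chain A B m X"
  using assms
proof (induction "card {C. C < B}" arbitrary: B rule: less_induct)
  case less
  show ?case
  proof (cases "A = B")
    case True
    then show ?thesis using maximal_chain_0 by blast
  next
    case False
    then have "A \<in> {C. A \<le> C \<and> C < B}" using less.prems by simp
    then obtain C where C: "A \<le> C" "C < B"
      and max: "\<And>D. A \<le> D \<Longrightarrow> D < B \<Longrightarrow> C \<le> D \<Longrightarrow> C = D"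
      using finite_has_maximal[of "{C. A \<le> C \<and> C < B}"] by auto
    have "C \<lessdot> B"
      unfolding covers_def using C max by (metis less_imp_le less_irrefl order_trans)
    \<comment> \<open>The inclusion is strict because \<open>C\<close> lies below \<open>B\<close>
      but not strictly below itself.\<close>
    moreover have "card {D. D < C} < card {D. D < B}"
      using C(2) by (intro psubset_card_mono) auto
    ultimately show ?thesis
      using less.hyps C(1) maximal_chain_extend by blast
  qed
qed

lemma chain_weight_weight_of_rank:
  assumes "maximal_chain A B m X"
  shows "chain_weight (weight_of_rank r) m X = r B - r A"
  using assms sum_telescope''[of 0 m "\<lambda>i. r (X i)"]
  by (simp add: chain_weight_def weight_of_rank_def maximal_chain_def)

lemma chain_weight_cong:
  assumes "maximal_chain A B m X" and "\<And>C D. C \<lessdot> D \<Longrightarrow> v C D = w C D"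
  shows "chain_weight v m X = chain_weight w m X"
  using assms unfolding chain_weight_def maximal_chain_def by (intro sum.cong) auto

text \<open>Agreement is demanded on covers only, since \<open>w\<close> carries no meaning
  elsewhere. Thus the formula applies both to the weight of a rank function and to a given
  \<open>w\<close> with \<open>r\<close> taken as \<open>rank_of_weight w\<close>.\<close>

lemma interval_weight_eq:
  assumes "\<And>C D. C \<lessdot> D \<Longrightarrow> w C D = weight_of_rank r C D"
    and "A \<le> (B :: 'a::{finite,lattice})"
  shows "interval_weight w A B = r B - r A"
proof -
  have "chain_weight w m X = r B - r A" if "maximal_chain A B m X" for m X
    using chain_weight_cong[OF that assms(1)] chain_weight_weight_of_rank[OF that] by simp
  with maximal_chain_exists[OF assms(2)] show ?thesis
    unfolding interval_weight_def by (intro the_equality) fastforce+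
qed

lemma IW1_weight_of_rank: "IW1 (weight_of_rank r)"
  unfolding IW1_def using chain_weight_weight_of_rank by metis

text \<open>After telescoping, the inequality at \<open>A\<close>, \<open>X\<close> is (R3) at
  \<open>X\<close>, \<open>A\<close>. One direction yields (IW2) for \<open>w\<^sub>r\<close>, the
  other (R3) for \<open>r\<^sub>w\<close>.\<close>

lemma submodular_iff_R3:
  fixes w :: "'a::{finite,lattice} \<Rightarrow> 'a \<Rightarrow> real"
  assumes "\<And>C D. C \<lessdot> D \<Longrightarrow> w C D = weight_of_rank r C D"
  shows "(\<forall>A X. interval_weight w A (sup X A) \<le> interval_weight w (inf A X) X) \<longleftrightarrow> R3 r"
proof -
  have "interval_weight w A (sup X A) \<le> interval_weight w (inf A X) X
      \<longleftrightarrow> r X - r (inf X A) \<ge> r (sup X A) - r A" for A X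
    by (simp add: interval_weight_eq[OF assms] inf_commute)
  then show ?thesis unfolding R3_def by blast
qed

lemma rank_of_weight_eq_interval_weight: "rank_of_weight w A = interval_weight w bot A"
  by (simp add: rank_of_weight_def interval_weight_def)

lemma interval_weight_eq_chain_weight:
  assumes "IW1 w" and "A \<le> B" and "maximal_chain A B m X"
  shows "interval_weight w A B = chain_weight w m X"
  unfolding interval_weight_def
  using assms unfolding IW1_def by (intro the_equality) blast+

lemma weight_eq_weight_of_rank_of_weight:
  fixes w :: "'a::{finite,bounded_lattice_bot} \<Rightarrow> 'a \<Rightarrow> real"
  assumes "IW1 w" and "A \<lessdot> B"
  shows "w A B = weight_of_rank (rank_of_weight w) A B"
proof -
  obtain m X where X: "maximal_chain bot A m X"
    using maximal_chain_exists[of bot A] by auto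
  have "rank_of_weight w B = chain_weight w (Suc m) (X(Suc m := B))"
    using interval_weight_eq_chain_weight[OF assms(1) _ maximal_chain_extend[OF X assms(2)]]
    by (simp add: rank_of_weight_eq_interval_weight)
  also have "\<dots> = rank_of_weight w A + w A B"
    using interval_weight_eq_chain_weight[OF assms(1) _ X] X
    by (simp add: chain_weight_extend rank_of_weight_eq_interval_weight maximal_chain_def)
  finally show ?thesis by (simp add: weight_of_rank_def)
qed

lemma strict_chain_less:
  fixes X :: "nat \<Rightarrow> 'a::order"
  assumes "\<forall>i\<in>{1..m}. X (i - 1) < X i" and "i < j" and "j \<le> m"
  shows "X i < X j"
  using assms(2,3)
proof (induction j)
  case (Suc j)
  then have "X j < X (Suc j)" using assms(1) by (auto dest: bspec[of _ _ "Suc j"])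
  with Suc show ?case by (cases "i = j") (auto intro: less_trans)
qed simp

text \<open>A strict chain visits \<open>m + 1\<close> distinct elements. The bound makes the set of
  lengths in \<open>height\<close> finite, so that its \<open>Max\<close> is a genuine
  maximum.\<close>

lemma strict_chain_length_less_card:
  fixes X :: "nat \<Rightarrow> 'a::{finite,order}"
  assumes "\<forall>i\<in>{1..m}. X (i - 1) < X i"
  shows "m < card (UNIV :: 'a set)"
proof -
  have "inj_on X {0..m}"
  proof (rule linorder_inj_onI')
    fix i j assume "i \<in> {0..m}" "j \<in> {0..m}" "i < j"
    then show "X i \<noteq> X j" using strict_chain_less[OF assms, of i j] by auto
  qed
  then have "card {0..m} \<le> card (UNIV :: 'a set)"
    by (intro card_inj_on_le) auto
  then show ?thesis by simp
qed

lemma height_bot: "height (bot :: 'a::{finite,bounded_lattice_bot}) = 0"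
proof -
  have "m = 0"
    if "X 0 = (bot :: 'a)" "X m = bot" "\<forall>i\<in>{1..m}. X (i - 1) < X i" for m :: nat and X
    using strict_chain_less[OF that(3), of 0 m] that by (cases m) auto
  then have "{m :: nat. \<exists>X. X 0 = (bot :: 'a) \<and> X m = bot \<and> (\<forall>i\<in>{1..m}. X (i - 1) < X i)} = {0}"
    by (intro equalityI subsetI) (blast, force)
  then show ?thesis by (simp add: height_def)
qed

text \<open>Covers are strict inequalities, so \<open>m\<close> is one of the lengths over which
  \<open>height\<close> takes the maximum.\<close>

lemma maximal_chain_length_le_height:
  fixes A :: "'a::{finite,bounded_lattice_bot}"
  assumes "maximal_chain bot A m X"
  shows "m \<le> height A"
  unfolding height_def
proof (rule Max_ge)
  show "finite {m :: nat. \<exists>X. X 0 = bot \<and> X m = A \<and> (\<forall>i\<in>{1..m}. X (i - 1) < X i)}"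
    by (rule finite_subset[of _ "{..<card (UNIV :: 'a set)}"])
      (use strict_chain_length_less_card in \<open>blast, simp\<close>)
qed (use assms in \<open>auto simp: maximal_chain_def covers_def\<close>)

text \<open>At \<open>bot\<close> the bounds of (R1) are both 0. This normalisation lets
  \<open>r\<close> be recovered exactly from its differences.\<close>

lemma rank_function_bot: "rank_function r \<Longrightarrow> r bot = 0"
  unfolding rank_function_def R1_def
  by (metis antisym height_bot mult_zero_right of_nat_0)

text \<open>The difference \<open>r B - r A\<close> is a sum of nonnegative cover weights along any
  maximal chain from \<open>A\<close> to \<open>B\<close>.\<close>

lemma R2_if_mono_on_covers:
  fixes r :: "'a::{finite,lattice} \<Rightarrow> real"
  assumes "cover_weighted (weight_of_rank r)"
  shows "R2 r"
  unfolding R2_def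
proof (intro allI impI)
  fix A B :: 'a assume "A \<le> B"
  then obtain m X where X: "maximal_chain A B m X"
    using maximal_chain_exists by blast
  have "0 \<le> chain_weight (weight_of_rank r) m X"
    using X assms unfolding chain_weight_def maximal_chain_def cover_weighted_def
    by (intro sum_nonneg) auto
  then show "r A \<le> r B" using chain_weight_weight_of_rank[OF X, of r] by simp
qed

text \<open>A maximal chain from \<open>bot\<close> to \<open>A\<close> has at most
  \<open>height A\<close> steps, and each step contributes at most \<open>t\<close>.\<close>

lemma R1_if_mono_on_covers:
  fixes r :: "'a::{finite,bounded_lattice_bot} \<Rightarrow> real"
  assumes "cover_weighted (weight_of_rank r)" and "r bot = 0"
  shows "\<exists>t\<ge>0. R1 t r"
proof -
  define P where "P = {(C :: 'a, D). C \<lessdot> D}"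
  define t where "t = (\<Sum>(C, D)\<in>P. weight_of_rank r C D)"
  have nonneg: "0 \<le> (case p of (C, D) \<Rightarrow> weight_of_rank r C D)" if "p \<in> P" for p
    using that assms(1) by (auto simp: P_def cover_weighted_def)
  have t0: "0 \<le> t" unfolding t_def using nonneg by (rule sum_nonneg)
  \<comment> \<open>A single summand is at most the whole sum because all summands are
    nonnegative.\<close>
  have le_t: "weight_of_rank r C D \<le> t" if "C \<lessdot> D" for C D
    using member_le_sum[of "(C, D)" P "\<lambda>(C, D). weight_of_rank r C D"] that nonneg
    by (auto simp: t_def P_def)
  have "R1 t r"
    unfolding R1_def
  proof (intro allI conjI)
    fix A :: 'a
    show "0 \<le> r A"
      using R2_if_mono_on_covers[OF assms(1)] assms(2) unfolding R2_def by (metis bot_least)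
    obtain m X where X: "maximal_chain bot A m X"
      using maximal_chain_exists[of bot A] by auto
    have "r A = chain_weight (weight_of_rank r) m X"
      using chain_weight_weight_of_rank[OF X, of r] assms(2) by simp
    also have "\<dots> \<le> real (card {1..m}) * t"
      using X le_t unfolding chain_weight_def maximal_chain_def
      by (intro sum_bounded_above) auto
    also have "\<dots> \<le> t * real (height A)"
      using maximal_chain_length_le_height[OF X] t0
      by (simp add: mult.commute mult_left_mono)
    finally show "r A \<le> t * real (height A)" .
  qed
  with t0 show ?thesis by blast
qed

lemma cover_weighted_weight_of_rank: "R2 r \<Longrightarrow> cover_weighted (weight_of_rank r)"
  unfolding cover_weighted_def R2_def weight_of_rank_def covers_def
  by (metis diff_ge_0_iff_ge less_imp_le)

lemma rank_function_rank_of_weight: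
  fixes w :: "'a::{finite,bounded_lattice_bot} \<Rightarrow> 'a \<Rightarrow> real"
  assumes "cover_weighted w" and "IW2 w"
  shows "rank_function (rank_of_weight w)"
proof -
  have "IW1 w" using assms(2) by (simp add: IW2_def)
  note w_eq = weight_eq_weight_of_rank_of_weight[OF this]
  have "cover_weighted (weight_of_rank (rank_of_weight w))"
    using assms(1) w_eq by (simp add: cover_weighted_def)
  \<comment> \<open>This is the weight of the interval from \<open>bot\<close> to
    \<open>bot\<close>, which telescopes to a difference of two equal terms.\<close>
  moreover have "rank_of_weight w bot = 0"
    using interval_weight_eq[OF w_eq, of bot bot]
    by (simp add: rank_of_weight_eq_interval_weight)
  moreover have "R3 (rank_of_weight w)"
    using submodular_iff_R3[OF w_eq] assms(2) by (simp add: IW2_def)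
  ultimately show ?thesis
    unfolding rank_function_def using R1_if_mono_on_covers R2_if_mono_on_covers by blast
qed

theorem theorem3p3:
  fixes w :: "'a::{finite,bounded_lattice_bot} \<Rightarrow> 'a \<Rightarrow> real"
  assumes "cover_weighted w"
  shows
    "(\<forall>r :: 'a \<Rightarrow> real. rank_function r \<longrightarrow>
        cover_weighted (weight_of_rank r) \<and> IW1 (weight_of_rank r) \<and> IW2 (weight_of_rank r)) \<and>
     (IW1 w \<and> IW2 w \<longrightarrow>
        (\<forall>A. \<exists>!s. \<exists>m X. maximal_chain bot A m X \<and> s = chain_weight w m X) \<and>
        rank_function (rank_of_weight w)) \<and>
     (IW1 w \<and> IW2 w \<longrightarrow>
        (\<forall>A B. A \<lessdot> B \<longrightarrow> weight_of_rank (rank_of_weight w) A B = w A B)) \<and>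
     (\<forall>r :: 'a \<Rightarrow> real. rank_function r \<longrightarrow> rank_of_weight (weight_of_rank r) = r)"
proof (intro conjI allI impI)
  fix r :: "'a \<Rightarrow> real" assume r: "rank_function r"
  then show "cover_weighted (weight_of_rank r)"
    by (simp add: rank_function_def cover_weighted_weight_of_rank)
  show "IW1 (weight_of_rank r)" by (rule IW1_weight_of_rank)
  then show "IW2 (weight_of_rank r)"
    using r submodular_iff_R3[of "weight_of_rank r" r] by (simp add: IW2_def rank_function_def)
  \<comment> \<open>Telescoping from \<open>bot\<close> to \<open>A\<close> gives
    \<open>r A - r bot\<close>, and \<open>r bot\<close> vanishes.\<close>
  show "rank_of_weight (weight_of_rank r) = r"
    using r interval_weight_eq[of "weight_of_rank r" r bot]
    by (simp add: fun_eq_iff rank_of_weight_eq_interval_weight rank_function_bot)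
next
  fix A :: 'a assume IW: "IW1 w \<and> IW2 w"
  obtain m X where "maximal_chain bot A m X"
    using maximal_chain_exists[of bot A] by auto
  \<comment> \<open>The chain just obtained gives existence; (IW1) on the interval from
    \<open>bot\<close> to \<open>A\<close> gives uniqueness.\<close>
  then show "\<exists>!s. \<exists>m X. maximal_chain bot A m X \<and> s = chain_weight w m X"
    using IW unfolding IW1_def by (metis bot_least)
next
  assume "IW1 w \<and> IW2 w"
  then show "rank_function (rank_of_weight w)"
    using rank_function_rank_of_weight assms by blast
next
  fix A B :: 'a assume "IW1 w \<and> IW2 w" "A \<lessdot> B"
  then show "weight_of_rank (rank_of_weight w) A B = w A B"
    by (simp add: weight_eq_weight_of_rank_of_weight)
qed

end
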